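(* Let $m\ge1$ and let $n_1, \ldots, n_m \geq 2$ be integers, and let $M$ be the complement of a $(2 ; n_1, \ldots, n_m)$ circulant block diagonal matrix. Let $m_{even}$ denote the number of indices $i \in [m]$ for which $n_i$ is even, let $n_{even}$ denote the sum of the $n_i$'s that are even, let $n_{odd}$ denote the sum of the $n_i$'s that are odd, and put $n = n_{even} + n_{odd}$. Suppose that $n$ is odd and that \[n > 2 \cdot m_{even} + n_{odd} \cdot (n_{odd}-2).\] Then $\mathrm{rank}_{\mathrm{bin}}(M) = n-m_{even}+1$.
   Context: For integers $n \ge k \ge 0$, $D_{n,k}$ denotes the $n\times n$ circulant $0,1$ matrix whose first row consists of $n-k$ ones followed by $k$ zeros, each subsequent row being the cyclic shift of the previous row by one position to the right. For integers $n_i\ge 2$, a $(2;n_1,\ldots,n_m)$ circulant block diagonal matrix is a block matrix with $m$ diagonal blocks whose $i$th diagonal block is $D_{n_i,n_i-2}$ (first row: two ones followed by $n_i-2$ zeros) and all of whose other entries are zero. The complement of a $0,1$ matrix is obtained by swapping zeros and ones. The binary rank $\mathrm{rank}_{\mathrm{bin}}(A)$ is the smallest number of combinatorial rectangles (all-one submatrices indexed by a set of rows times a set of columns) that partition the ones of $A$. *)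

theory Defs
  imports "Jordan_Normal_Form.Matrix" "HOL-Library.Disjoint_Sets"
begin

text \<open>Row and column indices are 0-based, and the matrix entries are the integers 0 and 1.
  Shifting the first row \<open>i\<close> times to the right moves its entry at position \<open>(j - i) mod n\<close>
  to position \<open>j\<close>.\<close>

definition circulant_D :: "nat \<Rightarrow> nat \<Rightarrow> int mat" where
  "circulant_D n k =
     mat n n (\<lambda>(i, j). if (int j - int i) mod int n < int n - int k then 1 else 0)"

definition circulant_block_diag :: "nat \<Rightarrow> nat list \<Rightarrow> int mat" where
  "circulant_block_diag k ns = diag_block_mat (map (\<lambda>n. circulant_D n (n - k)) ns)"

definition complement_mat :: "int mat \<Rightarrow> int mat" where
  "complement_mat A = map_mat (\<lambda>x. 1 - x) A"

definition one_entries :: "int mat \<Rightarrow> (nat \<times> nat) set" where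
  "one_entries A = {(i, j). i < dim_row A \<and> j < dim_col A \<and> A $$ (i, j) = 1}"

definition is_rectangle :: "int mat \<Rightarrow> (nat \<times> nat) set \<Rightarrow> bool" where
  "is_rectangle A B \<longleftrightarrow>
     (\<exists>S T. S \<subseteq> {..<dim_row A} \<and> T \<subseteq> {..<dim_col A} \<and> B = S \<times> T \<and> B \<subseteq> one_entries A)"

definition binary_rank :: "int mat \<Rightarrow> nat" where
  "binary_rank A =
     (LEAST r. \<exists>P. finite P \<and> card P = r \<and> partition_on (one_entries A) P \<and>
                   (\<forall>B\<in>P. is_rectangle A B))"

end

theory Submission imports Defs "Jordan_Normal_Form.Determinant" begin

text \<open>
  Index rows and columns by pairs (block, position), so that \<open>M\<close> vanishes exactly at an index and
  its cyclic successor in the block. Let \<open>c = n - m_even\<close>, the real rank of \<open>M\<close>.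

  Lower bound. Suppose that \<open>c\<close> rectangles \<open>S\<^sub>k \<times> T\<^sub>k\<close> partition the ones of \<open>M\<close>. Adjoin, for each even
  block, the single cell of its wrap-around entry. The resulting decomposition into \<open>n\<close> rectangles is
  that of an invertible matrix with an explicit inverse, and commuting the two factors past the
  inverse gives biorthogonality relations between the \<open>S\<^sub>k\<close> and the \<open>T\<^sub>k\<close>. Off the diagonal they say
  that each \<open>S\<^sub>k\<close> and \<open>T\<^sub>k\<close> meets the even and odd positions of every even block equally often; on
  the diagonal they then become \<open>|S\<^sub>k| |T\<^sub>k| = 2 (n - 2) (1 + h)\<close>, where \<open>h\<close> is half-integral, and
  integral if \<open>S\<^sub>k\<close> or \<open>T\<^sub>k\<close> avoids the odd blocks. Writing \<open>a\<^sub>k\<close> for the number of cells of \<open>S\<^sub>k \<times> T\<^sub>k\<close>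
  with both indices in odd blocks, \<open>|S\<^sub>k| |T\<^sub>k| \<ge> (n - 2) (2 - a\<^sub>k)\<close>. Summing over \<open>k\<close> yields
  \<open>n \<ge> 2 c - n_odd (n_odd - 2)\<close>, contrary to the hypothesis.

  Upper bound. A row of an even block is the union of two column sets, determined by its even and its
  odd zero, respectively; choosing one of the former to be common to all even blocks saves one
  rectangle per even block.
\<close>

section \<open>Square factorizations and rectangle decompositions\<close>

text \<open>A one-sided inverse of a square matrix is two-sided; enumerating \<open>I\<close> and
  \<open>K\<close> carries this over to arbitrary index sets of equal size.\<close>

lemma right_inverse_imp_left_inverse_on:
  fixes f :: "'i \<Rightarrow> 'k \<Rightarrow> 'a::field"
  assumes fin: "finite I" "finite K" and card: "card I = card K"
    and inv: "\<And>i j. i \<in> I \<Longrightarrow> j \<in> I \<Longrightarrow> (\<Sum>k\<in>K. f i k * g k j) = of_bool (i = j)"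
    and k: "k \<in> K" and l: "l \<in> K"
  shows "(\<Sum>i\<in>I. g k i * f i l) = of_bool (k = l)"
proof -
  define n where "n = card I"
  obtain a where a: "bij_betw a {..<n} I"
    using ex_bij_betw_nat_finite[OF fin(1)] by (auto simp: n_def atLeast0LessThan)
  obtain b where b: "bij_betw b {..<n} K"
    using ex_bij_betw_nat_finite[OF fin(2)] by (auto simp: n_def card atLeast0LessThan)
  define A where "A = mat n n (\<lambda>(i, k). f (a i) (b k))"
  define B where "B = mat n n (\<lambda>(k, i). g (b k) (a i))"
  have aI: "a i \<in> I" if "i < n" for i using a that by (auto simp: bij_betw_def)
  have "A * B = 1\<^sub>m n"
  proof (rule eq_matI)
    fix i j assume "i < dim_row (1\<^sub>m n)" "j < dim_col (1\<^sub>m n)"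
    then have ij: "i < n" "j < n" by auto
    have "(A * B) $$ (i, j) = (\<Sum>k<n. f (a i) (b k) * g (b k) (a j))"
      using ij by (simp add: A_def B_def scalar_prod_def atLeast0LessThan)
    also have "\<dots> = (\<Sum>k\<in>K. f (a i) k * g k (a j))"
      by (rule sum.reindex_bij_betw[OF b])
    also have "\<dots> = of_bool (i = j)"
      using inv[OF aI aI] ij bij_betw_imp_inj_on[OF a] by (auto simp: inj_on_def)
    finally show "(A * B) $$ (i, j) = 1\<^sub>m n $$ (i, j)" using ij by simp
  qed (auto simp: A_def B_def)
  then have BA: "B * A = 1\<^sub>m n"
    by (intro mat_mult_left_right_inverse[of A n B]) (auto simp: A_def B_def)
  obtain k' l' where kl: "k' < n" "l' < n" "b k' = k" "b l' = l"
    using k l b by (auto simp: bij_betw_def)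
  have "(\<Sum>i\<in>I. g k i * f i l) = (\<Sum>i<n. g k (a i) * f (a i) l)"
    by (rule sum.reindex_bij_betw[OF a, symmetric])
  also have "\<dots> = (B * A) $$ (k', l')"
    using kl by (simp add: A_def B_def scalar_prod_def atLeast0LessThan)
  also have "\<dots> = of_bool (k = l)" using BA kl bij_betw_imp_inj_on[OF b] by (auto simp: inj_on_def)
  finally show ?thesis .
qed

text \<open>The sum counts the rectangles through a cell, so a 0,1 matrix forces them to be disjoint
  and to lie on ones. Clipping to the matrix may leave empty rectangles, which a partition excludes;
  hence only an inequality.\<close>

lemma binary_rank_le:
  fixes S T :: "'k \<Rightarrow> nat set"
  assumes "finite K"
    and bin: "\<And>i j. i < dim_row A \<Longrightarrow> j < dim_col A \<Longrightarrow> A $$ (i, j) \<in> {0, 1}"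
    and dec: "\<And>i j. i < dim_row A \<Longrightarrow> j < dim_col A \<Longrightarrow>
      A $$ (i, j) = (\<Sum>k\<in>K. of_bool (i \<in> S k) * of_bool (j \<in> T k))"
  shows "binary_rank A \<le> card K"
proof -
  define R where "R k = (S k \<inter> {..<dim_row A}) \<times> (T k \<inter> {..<dim_col A})" for k
  define P where "P = R ` K - {{}}"
  have card_eq: "A $$ (i, j) = int (card {k \<in> K. (i, j) \<in> R k})"
    if "i < dim_row A" "j < dim_col A" for i j
  proof -
    have "A $$ (i, j) = (\<Sum>k\<in>K. of_bool ((i, j) \<in> R k))"
      using that by (simp add: dec R_def of_bool_conj)
    also have "\<dots> = int (card {k \<in> K. (i, j) \<in> R k})"
      using \<open>finite K\<close> by (simp add: Int_def of_bool_def sum.If_cases)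
    finally show ?thesis .
  qed
  have sub: "R k \<subseteq> one_entries A" if "k \<in> K" for k
  proof (rule subrelI)
    fix i j assume ij: "(i, j) \<in> R k"
    then have d: "i < dim_row A" "j < dim_col A" by (auto simp: R_def)
    have "card {k \<in> K. (i, j) \<in> R k} \<noteq> 0" using ij that \<open>finite K\<close> by auto
    then show "(i, j) \<in> one_entries A"
      using card_eq[OF d] bin[OF d] d by (auto simp: one_entries_def)
  qed
  have "partition_on (one_entries A) P"
  proof (rule partition_onI)
    show "\<Union>P = one_entries A"
    proof
      show "\<Union>P \<subseteq> one_entries A" using sub by (auto simp: P_def)
      show "one_entries A \<subseteq> \<Union>P"
      proof (rule subrelI)
        fix i j assume "(i, j) \<in> one_entries A"
        then have "card {k \<in> K. (i, j) \<in> R k} \<noteq> 0"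
          using card_eq[of i j] by (auto simp: one_entries_def)
        then have "{k \<in> K. (i, j) \<in> R k} \<noteq> {}" by (metis card.empty)
        then show "(i, j) \<in> \<Union>P" by (auto simp: P_def)
      qed
    qed
    fix p q assume pq: "p \<in> P" "q \<in> P" "p \<noteq> q"
    then obtain k l where kl: "k \<in> K" "l \<in> K" "p = R k" "q = R l" "k \<noteq> l"
      by (auto simp: P_def)
    show "disjnt p q"
    proof (rule ccontr)
      assume "\<not> disjnt p q"
      then obtain i j where ij: "(i, j) \<in> R k" "(i, j) \<in> R l" using kl by (auto simp: disjnt_def)
      then have d: "i < dim_row A" "j < dim_col A" by (auto simp: R_def)
      have "card {k, l} \<le> card {k \<in> K. (i, j) \<in> R k}"
        using ij kl \<open>finite K\<close> by (intro card_mono) auto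
      then show False using card_eq[OF d] bin[OF d] kl by auto
    qed
  qed (auto simp: P_def)
  moreover have "is_rectangle A B" if "B \<in> P" for B
  proof -
    obtain k where "k \<in> K" "B = R k" using \<open>B \<in> P\<close> by (auto simp: P_def)
    then show ?thesis using sub[of k] unfolding is_rectangle_def
      by (intro exI[of _ "S k \<inter> {..<dim_row A}"] exI[of _ "T k \<inter> {..<dim_col A}"])
        (auto simp: R_def)
  qed
  moreover have "finite P" using \<open>finite K\<close> by (simp add: P_def)
  ultimately have "binary_rank A \<le> card P"
    unfolding binary_rank_def by (intro Least_le exI[of _ P]) auto
  also have "\<dots> \<le> card (R ` K)" using \<open>finite K\<close> by (auto simp: P_def intro: card_mono)
  also have "\<dots> \<le> card K" by (rule card_image_le[OF \<open>finite K\<close>])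
  finally show ?thesis .
qed

lemma binary_rank_le_imp_decomposition:
  fixes A :: "int mat"
  assumes "binary_rank A \<le> c"
    and bin: "\<And>i j. i < dim_row A \<Longrightarrow> j < dim_col A \<Longrightarrow> A $$ (i, j) \<in> {0, 1}"
  obtains S T :: "nat \<Rightarrow> nat set" where "\<And>i j. i < dim_row A \<Longrightarrow> j < dim_col A \<Longrightarrow>
      A $$ (i, j) = (\<Sum>k<c. of_bool (i \<in> S k) * of_bool (j \<in> T k))"
proof -
  let ?Q = "\<lambda>r. \<exists>P. finite P \<and> card P = r \<and> partition_on (one_entries A) P \<and>
                   (\<forall>B\<in>P. is_rectangle A B)"
  have "finite (one_entries A)"
    by (rule finite_subset[of _ "{..<dim_row A} \<times> {..<dim_col A}"]) (auto simp: one_entries_def)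
  \<comment> \<open>The partition into single cells shows that the minimum is attained.\<close>
  then have "?Q (card ((\<lambda>x. {x}) ` one_entries A))"
    by (intro exI[of _ "(\<lambda>x. {x}) ` one_entries A"])
       (auto simp: partition_on_def disjoint_def is_rectangle_def one_entries_def
         intro!: exI[of _ "{_}"])
  then have "?Q (binary_rank A)" unfolding binary_rank_def by (rule LeastI)
  then obtain P where P: "finite P" "card P = binary_rank A" "partition_on (one_entries A) P"
    "\<forall>B\<in>P. is_rectangle A B" by blast
  then obtain S0 T0 where ST: "B = S0 B \<times> T0 B" if "B \<in> P" for B
    unfolding is_rectangle_def by metis
  let ?r = "binary_rank A"
  obtain h where h: "bij_betw h {..<?r} P"
    using ex_bij_betw_nat_finite[OF P(1)] P(2) by (auto simp: atLeast0LessThan)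
  \<comment> \<open>Empty rectangles pad the partition to exactly \<open>c\<close> terms.\<close>
  define S where "S k = (if k < ?r then S0 (h k) else {})" for k
  define T where "T k = (if k < ?r then T0 (h k) else {})" for k
  show thesis
  proof (rule that[of S T])
    fix i j assume d: "i < dim_row A" "j < dim_col A"
    have "(\<Sum>k<c. of_bool (i \<in> S k) * of_bool (j \<in> T k)) =
          (\<Sum>k<?r. of_bool (i \<in> S0 (h k)) * of_bool (j \<in> T0 (h k)) :: int)"
      using assms(1) by (intro sum.mono_neutral_cong_right) (auto simp: S_def T_def)
    also have "\<dots> = (\<Sum>B\<in>P. of_bool (i \<in> S0 B) * of_bool (j \<in> T0 B))"
      by (rule sum.reindex_bij_betw[OF h])
    also have "\<dots> = (\<Sum>B\<in>P. of_bool ((i, j) \<in> B))"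
    proof (rule sum.cong[OF refl])
      fix B assume "B \<in> P"
      from ST[OF this] have "(i, j) \<in> B \<longleftrightarrow> i \<in> S0 B \<and> j \<in> T0 B" by (metis mem_Sigma_iff)
      then show "of_bool (i \<in> S0 B) * of_bool (j \<in> T0 B) = (of_bool ((i, j) \<in> B) :: int)" by simp
    qed
    also have "\<dots> = of_bool ((i, j) \<in> one_entries A)"
    proof (cases "(i, j) \<in> one_entries A")
      case True
      then obtain B where B: "B \<in> P" "(i, j) \<in> B" using P(3) by (auto simp: partition_on_def)
      have "(i, j) \<notin> B'" if "B' \<in> P" "B' \<noteq> B" for B'
        using P(3) that B by (auto simp: partition_on_def disjoint_def)
      then have "(\<Sum>B\<in>P. of_bool ((i, j) \<in> B)) = (\<Sum>B'\<in>{B}. (1::int))"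
        using B P(1) by (intro sum.mono_neutral_cong_right) auto
      then show ?thesis using True by simp
    next
      case False
      then show ?thesis using P(3) by (auto simp: partition_on_def intro!: sum.neutral)
    qed
    also have "\<dots> = A $$ (i, j)" using d bin[OF d] by (auto simp: one_entries_def)
    finally show "A $$ (i, j) = (\<Sum>k<c. of_bool (i \<in> S k) * of_bool (j \<in> T k))" by simp
  qed
qed

section \<open>Block coordinates of matrix indices\<close>

definition block_idx :: "nat list \<Rightarrow> (nat \<times> nat) set" where
  "block_idx ns = (SIGMA b:{..<length ns}. {..<ns ! b})"

fun block_succ :: "nat list \<Rightarrow> nat \<times> nat \<Rightarrow> nat \<times> nat" where
  "block_succ ns (b, p) = (b, if Suc p = ns ! b then 0 else Suc p)"

text \<open>The recursion mirrors that of \<open>diag_block_mat\<close>, so that both unfold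
  together in an induction on \<open>ns\<close>.\<close>

fun block_loc :: "nat list \<Rightarrow> nat \<Rightarrow> nat \<times> nat" where
  "block_loc [] i = (0, i)"
| "block_loc (x # xs) i = (if i < x then (0, i) else apfst Suc (block_loc xs (i - x)))"

lemma block_idx_Cons:
  "block_idx (x # xs) = Pair 0 ` {..<x} \<union> apfst Suc ` block_idx xs"
proof (rule Set.set_eqI)
  fix z :: "nat \<times> nat"
  obtain b p where z: "z = (b, p)" by fastforce
  show "z \<in> block_idx (x # xs) \<longleftrightarrow> z \<in> Pair 0 ` {..<x} \<union> apfst Suc ` block_idx xs"
    by (cases b) (auto simp: z block_idx_def image_iff apfst_def map_prod_def split: prod.splits)
qed

lemma bij_betw_block_loc: "bij_betw (block_loc ns) {..<sum_list ns} (block_idx ns)"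
proof (induction ns)
  case Nil
  then show ?case by (simp add: block_idx_def bij_betw_def)
next
  case (Cons x xs)
  have 1: "bij_betw (block_loc (x # xs)) {..<x} (Pair 0 ` {..<x})"
    by (auto simp: bij_betw_def inj_on_def)
  have "bij_betw (\<lambda>i. i - x) {x..<x + sum_list xs} {..<sum_list xs}"
    by (rule bij_betwI[where g = "\<lambda>i. i + x"]) auto
  moreover have "bij_betw (apfst Suc) (block_idx xs) (apfst Suc ` block_idx xs)"
    by (auto simp: bij_betw_def inj_on_def apfst_def map_prod_def)
  ultimately have "bij_betw (apfst Suc \<circ> (block_loc xs \<circ> (\<lambda>i. i - x)))
      {x..<x + sum_list xs} (apfst Suc ` block_idx xs)"
    using Cons.IH by (blast intro: bij_betw_trans)
  then have 2: "bij_betw (block_loc (x # xs)) {x..<x + sum_list xs} (apfst Suc ` block_idx xs)"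
    by (rule bij_betw_cong[THEN iffD1, rotated]) auto
  have "bij_betw (block_loc (x # xs)) ({..<x} \<union> {x..<x + sum_list xs})
      (Pair 0 ` {..<x} \<union> apfst Suc ` block_idx xs)"
    by (rule bij_betw_combine[OF 1 2]) (auto simp: apfst_def map_prod_def)
  moreover have "{..<x} \<union> {x..<x + sum_list xs} = {..<sum_list (x # xs)}" by auto
  ultimately show ?case by (simp only: block_idx_Cons)
qed

text \<open>Since \<open>n - (n - 2) = 2\<close>, the ones are the cells where
  \<open>(j - i) mod n\<close> is 0 or 1.\<close>

lemma circulant_D_two_index:
  assumes "2 \<le> n" "i < n" "j < n"
  shows "circulant_D n (n - 2) $$ (i, j) = of_bool (j = i \<or> j = (if Suc i = n then 0 else Suc i))"
proof -
  have "(int j - int i) mod int n = (if i \<le> j then int j - int i else int j - int i + int n)"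
  proof (cases "i \<le> j")
    case True
    then show ?thesis using assms by (simp add: mod_pos_pos_trivial)
  next
    case False
    have "(int j - int i) mod int n = (int j - int i + int n) mod int n" by simp
    also have "\<dots> = int j - int i + int n"
      using False assms by (intro mod_pos_pos_trivial) auto
    finally show ?thesis using False by simp
  qed
  then show ?thesis using assms by (auto simp: circulant_D_def)
qed

lemma dim_circulant_block_diag [simp]:
  "dim_row (circulant_block_diag k ns) = sum_list ns"
  "dim_col (circulant_block_diag k ns) = sum_list ns"
  by (simp_all add: circulant_block_diag_def dim_diag_block_mat circulant_D_def comp_def)

lemma circulant_block_diag_two_index:
  assumes "\<forall>x\<in>set ns. 2 \<le> x" "i < sum_list ns" "j < sum_list ns"
  shows "circulant_block_diag 2 ns $$ (i, j) =
    of_bool (block_loc ns j = block_loc ns i \<or> block_loc ns j = block_succ ns (block_loc ns i))"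
  using assms
proof (induction ns arbitrary: i j)
  case Nil
  then show ?case by simp
next
  case (Cons x xs)
  let ?B = "circulant_block_diag 2 xs"
  have eq: "circulant_block_diag 2 (x # xs) = four_block_mat (circulant_D x (x - 2))
      (0\<^sub>m x (sum_list xs)) (0\<^sub>m (sum_list xs) x) ?B"
    using dim_circulant_block_diag[of 2 xs]
    by (simp add: circulant_block_diag_def Let_def circulant_D_def)
  have D: "dim_row (circulant_D x (x - 2)) = x" "dim_col (circulant_D x (x - 2)) = x"
    by (simp_all add: circulant_D_def)
  obtain b p where bp: "block_loc xs (i - x) = (b, p)" by fastforce
  obtain b' p' where bp': "block_loc xs (j - x) = (b', p')" by fastforce
  have IH: "?B $$ (i - x, j - x) =
    of_bool (block_loc xs (j - x) = block_loc xs (i - x) \<or>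
      block_loc xs (j - x) = block_succ xs (block_loc xs (i - x)))" if "\<not> i < x" "\<not> j < x"
    using Cons.prems that by (intro Cons.IH) auto
  have ij: "i < x + sum_list xs" "j < x + sum_list xs" "2 \<le> x" using Cons.prems by auto
  note index = index_mat_four_block(1)[of i "circulant_D x (x - 2)" ?B j,
      unfolded D dim_circulant_block_diag, OF ij(1,2)]
  show ?case
  proof (cases "i < x")
    case i: True
    show ?thesis
    proof (cases "j < x")
      case True
      then show ?thesis using i ij by (simp add: eq index circulant_D_two_index)
    next
      case False
      then show ?thesis using i ij by (simp add: eq index bp')
    qed
  next
    case i: False
    show ?thesis
    proof (cases "j < x")
      case True
      then show ?thesis using i ij by (simp add: eq index bp)
    next
      case False
      then show ?thesis using i ij IH[OF i False] by (simp add: eq index bp bp')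
    qed
  qed
qed


section \<open>The cyclic structure of the index set\<close>

locale cycle_blocks =
  fixes ns :: "nat list"
  assumes size_ge_2: "b < length ns \<Longrightarrow> 2 \<le> ns ! b"
begin

abbreviation "I \<equiv> block_idx ns"
abbreviation "\<sigma> \<equiv> block_succ ns"
definition "evens = {b. b < length ns \<and> even (ns ! b)}"
definition "odd_idx = {i \<in> I. odd (ns ! fst i)}"

lemma finite_I [simp]: "finite I" and finite_evens [simp]: "finite evens"
  and finite_odd_idx [simp]: "finite odd_idx"
  by (auto simp: block_idx_def evens_def odd_idx_def)

lemma card_I: "card I = sum_list ns"
  using bij_betw_same_card[OF bij_betw_block_loc[of ns]] by simp

lemma sum_I: "(\<Sum>i\<in>I. f i) = (\<Sum>b<length ns. \<Sum>p<ns ! b. f (b, p))"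
  unfolding block_idx_def by (subst sum.Sigma) (auto simp: case_prod_beta)

lemma succ_in_I: "i \<in> I \<Longrightarrow> \<sigma> i \<in> I"
  by (cases i) (auto simp: block_idx_def)

lemma succ_in_odd_idx: "i \<in> odd_idx \<Longrightarrow> \<sigma> i \<in> odd_idx"
  by (cases i) (auto simp: block_idx_def odd_idx_def)

lemma succ_neq: "i \<in> I \<Longrightarrow> \<sigma> i \<noteq> i"
  using size_ge_2[of "fst i"] by (cases i) (auto simp: block_idx_def)

text \<open>As \<sigma> preserves \<open>U\<close> and has no fixed point there, each row of
  \<open>U\<close> has exactly two zeros inside \<open>U\<close>. Applied to all indices and to
  those of the odd blocks.\<close>

lemma sum_entries:
  assumes "U \<subseteq> I" "\<And>i. i \<in> U \<Longrightarrow> \<sigma> i \<in> U"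
  shows "(\<Sum>i\<in>U. \<Sum>j\<in>U. of_bool (\<not> (j = i \<or> j = \<sigma> i))) = real (card U) * (real (card U) - 2)"
proof -
  have fin: "finite U" using assms(1) finite_I finite_subset by blast
  have "(\<Sum>j\<in>U. of_bool (\<not> (j = i \<or> j = \<sigma> i))) = real (card U) - 2" if "i \<in> U" for i
  proof -
    have "of_bool (\<not> (j = i \<or> j = \<sigma> i)) = (1 - of_bool (j = i) - of_bool (j = \<sigma> i) :: real)" for j
      using succ_neq[of i] assms that by auto
    then have "(\<Sum>j\<in>U. of_bool (\<not> (j = i \<or> j = \<sigma> i))) =
        (\<Sum>j\<in>U. 1 - of_bool (j = i) - of_bool (j = \<sigma> i) :: real)" by (intro sum.cong refl)
    also have "\<dots> = real (card U) - 2"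
      using fin that assms(2)[OF that] by (simp add: sum_subtractf of_bool_def)
    finally show ?thesis .
  qed
  then show ?thesis by simp
qed

section \<open>Explicit inverses of the cut matrix and of its complement\<close>

text \<open>\<open>cut\<close> is the block matrix with the wrap-around entry deleted from each even block, which
  makes these blocks invertible.\<close>

definition wrap :: "nat \<times> nat \<Rightarrow> bool" where
  "wrap i \<longleftrightarrow> even (ns ! fst i) \<and> Suc (snd i) = ns ! fst i"

definition cut :: "nat \<times> nat \<Rightarrow> nat \<times> nat \<Rightarrow> real" where
  "cut i j = of_bool (j = i) + of_bool (j = \<sigma> i \<and> \<not> wrap i)"

text \<open>The inverse of \<open>cut\<close>. An even block is \<open>1 + N\<close> with a
  nilpotent shift \<open>N\<close>, inverted by the sum of all \<open>(-N)^k\<close>. An odd block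
  of size \<open>m\<close> is \<open>1 + P\<close> with a cyclic shift \<open>P\<close>; as
  \<open>(-P)^m = -1\<close>, its inverse is half the sum of \<open>(-P)^k\<close> over
  \<open>k < m\<close>.\<close>

fun cut_inv :: "nat \<times> nat \<Rightarrow> nat \<times> nat \<Rightarrow> real" where
  "cut_inv (b, p) (b', q) = of_bool (b = b') * (-1) ^ (p + q) *
     (if even (ns ! b) then of_bool (p \<le> q) else if p \<le> q then 1 / 2 else - 1 / 2)"

fun cut_inv_row_sum :: "nat \<times> nat \<Rightarrow> real" where
  "cut_inv_row_sum (b, p) = (if even (ns ! b) then of_bool (odd p) else 1 / 2)"

fun cut_inv_col_sum :: "nat \<times> nat \<Rightarrow> real" where
  "cut_inv_col_sum (b, q) = (if even (ns ! b) then of_bool (even q) else 1 / 2)"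

lemma sum_cut_mult:
  assumes "i \<in> I"
  shows "(\<Sum>j\<in>I. cut i j * f j) = f i + (if wrap i then 0 else f (\<sigma> i))"
proof -
  have "(\<Sum>j\<in>I. cut i j * f j) =
      (\<Sum>j\<in>I. (if j = i then f j else 0) + (if j = \<sigma> i then if wrap i then 0 else f j else 0))"
    by (intro sum.cong) (auto simp: cut_def)
  then show ?thesis using assms succ_in_I[OF assms] by (simp add: sum.distrib)
qed

lemma cut_cut_inv:
  assumes "i \<in> I" "l \<in> I"
  shows "cut_inv i l + (if wrap i then 0 else cut_inv (\<sigma> i) l) = of_bool (i = l)"
proof -
  obtain b p where i: "i = (b, p)" by fastforce
  obtain b' q where l: "l = (b', q)" by fastforce
  show ?thesis
  proof (cases "b = b'")
    case False
    then show ?thesis by (simp add: i l)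
  next
    case True
    have p: "p < ns ! b" and q: "q < ns ! b" using assms True by (auto simp: i l block_idx_def)
    have sq: "(-1) ^ (q + q) = (1::real)" by simp
    show ?thesis
    proof (cases "Suc p = ns ! b")
      case last: True
      show ?thesis
      proof (cases "even (ns ! b)")
        case True
        then show ?thesis using \<open>b = b'\<close> last p q sq by (auto simp: i l wrap_def)
      next
        case False
        \<comment> \<open>At the seam of an odd block the last position and position 0 are both
          even, so the values \<open>-1/2\<close> and \<open>1/2\<close> cancel off the
          diagonal.\<close>
        then have "even p" using last by presburger
        then show ?thesis using False \<open>b = b'\<close> last p q
          by (cases "p = q") (auto simp: i l wrap_def power_add)
      qed
    next
      case False
      then show ?thesis using \<open>b = b'\<close> p q sq
        by (cases "p = q") (auto simp: i l wrap_def not_le)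
    qed
  qed
qed

text \<open>Certifies the closed form of the row sums of \<open>cut_inv\<close> as a solution
  \<open>x\<close> of \<open>cut * x = 1\<close>, with the all-one vector on the right.\<close>

lemma cut_row_sum:
  assumes "i \<in> I"
  shows "cut_inv_row_sum i + (if wrap i then 0 else cut_inv_row_sum (\<sigma> i)) = 1"
  using assms by (cases i) (auto simp: wrap_def block_idx_def dest: arg_cong[of _ _ even])

lemma sum_alternating: "(\<Sum>p<m. (-1) ^ p) = (of_bool (odd m) :: real)"
  by (induction m) auto

lemma sum_cut_inv:
  assumes "l \<in> I"
  shows "(\<Sum>j\<in>I. cut_inv j l) = cut_inv_col_sum l"
proof -
  obtain b q where l: "l = (b, q)" by fastforce
  have b: "b < length ns" and q: "q < ns ! b" using assms by (auto simp: l block_idx_def)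
  have le: "(\<Sum>p<ns ! b. (-1) ^ p * of_bool (p \<le> q)) = (of_bool (even q) :: real)"
  proof -
    have "(\<Sum>p<ns ! b. (-1) ^ p * of_bool (p \<le> q)) = (\<Sum>p<Suc q. (-1) ^ p :: real)"
      using q by (intro sum.mono_neutral_cong_right) auto
    then show ?thesis by (simp only: sum_alternating) simp
  qed
  have "(\<Sum>j\<in>I. cut_inv j l) = (\<Sum>b'<length ns. if b' = b then \<Sum>p<ns ! b. cut_inv (b, p) l else 0)"
    unfolding sum_I by (intro sum.cong) (auto simp: l)
  also have "\<dots> = (\<Sum>p<ns ! b. cut_inv (b, p) l)" using b by simp
  also have "\<dots> = cut_inv_col_sum l"
  proof (cases "even (ns ! b)")
    case True
    then have "(\<Sum>p<ns ! b. cut_inv (b, p) l) =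
        (-1) ^ q * (\<Sum>p<ns ! b. (-1) ^ p * of_bool (p \<le> q))"
      unfolding sum_distrib_left by (intro sum.cong) (auto simp: l power_add)
    then show ?thesis using True by (simp only: le) (simp add: l)
  next
    case False
    \<comment> \<open>In an odd block the coefficient \<plusminus>1/2 is rewritten as
      \<open>of_bool (p \<le> q) - 1/2\<close>.\<close>
    then have "(\<Sum>p<ns ! b. cut_inv (b, p) l) =
        (\<Sum>p<ns ! b. (-1) ^ q * ((-1) ^ p * of_bool (p \<le> q)) - (-1) ^ q / 2 * (-1) ^ p)"
      by (intro sum.cong) (auto simp: l power_add)
    also have "\<dots> = (-1) ^ q * of_bool (even q) - (-1) ^ q / 2"
      unfolding sum_subtractf sum_distrib_left[symmetric] le sum_alternating using False by simp
    finally show ?thesis using False by (simp add: l)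
  qed
  finally show ?thesis .
qed

text \<open>Row and column sums are 1/2 up to an alternating term on the even blocks, which balanced
  sets do not see.\<close>

lemma double_row_sum:
  "2 * cut_inv_row_sum j = 1 - of_bool (even (ns ! fst j)) * (-1) ^ snd j"
  by (cases j) auto

lemma double_col_sum:
  "2 * cut_inv_col_sum j = 1 + of_bool (even (ns ! fst j)) * (-1) ^ snd j"
  by (cases j) auto

lemma sum_row_sum: "2 * (\<Sum>j\<in>I. cut_inv_row_sum j) = card I"
proof -
  have "(\<Sum>j\<in>I. of_bool (even (ns ! fst j)) * (-1) ^ snd j) = (0::real)"
    unfolding sum_I by (simp add: sum_distrib_left[symmetric] sum_alternating)
  then show ?thesis
    by (simp add: sum_distrib_left double_row_sum sum_subtractf)
qed

text \<open>By the Sherman--Morrison formula, this is the inverse of the complement of \<open>cut\<close>.\<close>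

definition compl_inv :: "nat \<times> nat \<Rightarrow> nat \<times> nat \<Rightarrow> real" where
  "compl_inv j l =
     2 / (real (card I) - 2) * cut_inv_row_sum j * cut_inv_col_sum l - cut_inv j l"

text \<open>Applied to column \<open>l\<close> of \<open>compl_inv\<close>, the all-one matrix gives
  the constant \<gamma> and \<open>cut\<close> gives \<gamma> minus the unit vector at
  \<open>l\<close>; the difference is that unit vector.\<close>

lemma compl_inv_right:
  assumes "card I > 2" "i \<in> I" "l \<in> I"
  shows "(\<Sum>j\<in>I. (1 - cut i j) * compl_inv j l) = of_bool (i = l)"
proof -
  define \<gamma> where "\<gamma> = 2 / (real (card I) - 2) * cut_inv_col_sum l"
  have N: "compl_inv j l = \<gamma> * cut_inv_row_sum j - cut_inv j l" for j
    by (simp add: compl_inv_def \<gamma>_def)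
  have "(\<Sum>j\<in>I. compl_inv j l) = \<gamma> * (real (card I) / 2) - cut_inv_col_sum l"
    using sum_row_sum sum_cut_inv[OF assms(3)]
    by (simp add: N sum_subtractf sum_distrib_left[symmetric])
  \<comment> \<open>This equation determines the factor \<open>2 / (n - 2)\<close>.\<close>
  also have "\<dots> = \<gamma>" using assms(1) by (simp add: \<gamma>_def field_simps)
  finally have 1: "(\<Sum>j\<in>I. compl_inv j l) = \<gamma>" .
  have "(\<Sum>j\<in>I. cut i j * compl_inv j l) =
      \<gamma> * (cut_inv_row_sum i + (if wrap i then 0 else cut_inv_row_sum (\<sigma> i)))
      - (cut_inv i l + (if wrap i then 0 else cut_inv (\<sigma> i) l))"
    unfolding sum_cut_mult[OF assms(2)] by (simp add: N algebra_simps)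
  also have "\<dots> = \<gamma> - of_bool (i = l)"
    by (simp only: cut_row_sum[OF assms(2)] cut_cut_inv[OF assms(2,3)] mult_1_right)
  finally show ?thesis using 1 by (simp add: left_diff_distrib sum_subtractf)
qed

section \<open>Balance, integrality and the lower bound\<close>

text \<open>Summed over the even blocks, the assumption annuls the alternating terms of
  \<open>double_row_sum\<close> and \<open>double_col_sum\<close>.\<close>

lemma half_card_if_balanced:
  fixes t :: "nat \<times> nat \<Rightarrow> real"
  assumes "\<And>b. b \<in> evens \<Longrightarrow> (\<Sum>j\<in>I. t j * (of_bool (fst j = b) * (-1) ^ snd j)) = 0"
  shows "2 * (\<Sum>j\<in>I. t j * cut_inv_row_sum j) = (\<Sum>j\<in>I. t j)"
    and "2 * (\<Sum>j\<in>I. t j * cut_inv_col_sum j) = (\<Sum>j\<in>I. t j)"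
proof -
  have "(\<Sum>j\<in>I. t j * (of_bool (even (ns ! fst j)) * (-1) ^ snd j)) =
      (\<Sum>j\<in>I. \<Sum>b\<in>evens. t j * (of_bool (fst j = b) * (-1) ^ snd j))"
  proof (rule sum.cong[OF refl])
    fix j assume j: "j \<in> I"
    have "(\<Sum>b\<in>evens. t j * (of_bool (fst j = b) * (-1) ^ snd j)) =
        (\<Sum>b\<in>evens. if fst j = b then t j * (-1) ^ snd j else 0)"
      by (intro sum.cong) auto
    also have "\<dots> = t j * (of_bool (even (ns ! fst j)) * (-1) ^ snd j)"
      using j by (auto simp: evens_def block_idx_def)
    finally show "t j * (of_bool (even (ns ! fst j)) * (-1) ^ snd j) =
        (\<Sum>b\<in>evens. t j * (of_bool (fst j = b) * (-1) ^ snd j))" by simp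
  qed
  also have "\<dots> = (\<Sum>b\<in>evens. \<Sum>j\<in>I. t j * (of_bool (fst j = b) * (-1) ^ snd j))"
    by (rule sum.swap)
  also have "\<dots> = 0" using assms by simp
  finally have 0: "(\<Sum>j\<in>I. t j * (of_bool (even (ns ! fst j)) * (-1) ^ snd j)) = 0" .
  have "2 * (\<Sum>j\<in>I. t j * cut_inv_row_sum j) = (\<Sum>j\<in>I. t j * (2 * cut_inv_row_sum j))"
    by (simp add: sum_distrib_left mult_ac)
  also have "\<dots> = (\<Sum>j\<in>I. t j)"
    using 0 by (simp only: double_row_sum right_diff_distrib sum_subtractf) simp
  finally show "2 * (\<Sum>j\<in>I. t j * cut_inv_row_sum j) = (\<Sum>j\<in>I. t j)" .
  have "2 * (\<Sum>j\<in>I. t j * cut_inv_col_sum j) = (\<Sum>j\<in>I. t j * (2 * cut_inv_col_sum j))"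
    by (simp add: sum_distrib_left mult_ac)
  also have "\<dots> = (\<Sum>j\<in>I. t j)"
    using 0 by (simp only: double_col_sum distrib_left sum.distrib) simp
  finally show "2 * (\<Sum>j\<in>I. t j * cut_inv_col_sum j) = (\<Sum>j\<in>I. t j)" .
qed

lemma double_cut_inv_in_Ints: "2 * cut_inv j i \<in> \<int>"
  by (cases j; cases i) auto

text \<open>Halves occur only between two positions of the same odd block.\<close>

lemma cut_inv_in_Ints:
  assumes "j \<in> I" "i \<in> I" "j \<notin> odd_idx \<or> i \<notin> odd_idx"
  shows "cut_inv j i \<in> \<int>"
  using assms by (cases j; cases i) (auto simp: odd_idx_def block_idx_def)

lemma decomposition_size_bound:
  fixes S T :: "nat \<Rightarrow> (nat \<times> nat) set"
  assumes n: "card I > 2" and c: "c + card evens = card I"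
    and dec: "\<And>i j. i \<in> I \<Longrightarrow> j \<in> I \<Longrightarrow>
      (\<Sum>k<c. of_bool (i \<in> S k) * of_bool (j \<in> T k)) = (of_bool (\<not> (j = i \<or> j = \<sigma> i)) :: real)"
  shows "2 * real c \<le> real (card I) + real (card odd_idx) * (real (card odd_idx) - 2)"
proof -
  define s where "s k i = (of_bool (i \<in> S k) :: real)" for k i
  define t where "t k j = (of_bool (j \<in> T k) :: real)" for k j
  \<comment> \<open>\<open>Inl\<close> indexes the given rectangles, \<open>Inr b\<close> the
    wrap-around cell of an even block, which is 0 in the decomposed matrix but 1 in
    \<open>1 - cut\<close>. The assumption on \<open>c\<close> makes \<open>K\<close> as large as
    \<open>I\<close>.\<close>
  define K where "K = {..<c} <+> evens"
  define f where "f i \<kappa> = (case \<kappa> of Inl k \<Rightarrow> s k i | Inr b \<Rightarrow> of_bool (i = (b, ns ! b - 1)))" for i \<kappa>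
  define g where "g \<kappa> j = (case \<kappa> of Inl k \<Rightarrow> t k j | Inr b \<Rightarrow> of_bool (j = (b, 0)))" for \<kappa> j
  define g' where "g' \<kappa> l = (\<Sum>j\<in>I. g \<kappa> j * compl_inv j l)" for \<kappa> l
  have fg: "(\<Sum>\<kappa>\<in>K. f i \<kappa> * g \<kappa> j) = 1 - cut i j" if i: "i \<in> I" and j: "j \<in> I" for i j
  proof -
    have "(\<Sum>\<kappa>\<in>K. f i \<kappa> * g \<kappa> j) = (\<Sum>k<c. s k i * t k j) +
        (\<Sum>b\<in>evens. of_bool (i = (b, ns ! b - 1)) * of_bool (j = (b, 0)))"
      by (simp add: K_def sum.Plus f_def g_def comp_def)
    also have "(\<Sum>b\<in>evens. of_bool (i = (b, ns ! b - 1)) * of_bool (j = (b, 0))) =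
        (\<Sum>b\<in>evens. if b = fst i then of_bool (wrap i \<and> j = \<sigma> i) else 0 :: real)"
    proof (rule sum.cong[OF refl])
      fix b assume "b \<in> evens"
      then show "of_bool (i = (b, ns ! b - 1)) * of_bool (j = (b, 0)) =
          (if b = fst i then of_bool (wrap i \<and> j = \<sigma> i) else 0 :: real)"
        using i size_ge_2[of b] by (cases i) (auto simp: evens_def wrap_def block_idx_def)
    qed
    also have "\<dots> = of_bool (wrap i \<and> j = \<sigma> i)"
      using i by (auto simp: evens_def wrap_def block_idx_def)
    also have "(\<Sum>k<c. s k i * t k j) = of_bool (\<not> (j = i \<or> j = \<sigma> i))"
      unfolding s_def t_def by (rule dec[OF i j])
    finally show ?thesis using succ_neq[OF i] by (auto simp: cut_def)
  qed
  have "(\<Sum>\<kappa>\<in>K. f i \<kappa> * g' \<kappa> l) = of_bool (i = l)" if "i \<in> I" "l \<in> I" for i l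
  proof -
    have "(\<Sum>\<kappa>\<in>K. f i \<kappa> * g' \<kappa> l) = (\<Sum>\<kappa>\<in>K. \<Sum>j\<in>I. f i \<kappa> * g \<kappa> j * compl_inv j l)"
      by (simp add: g'_def sum_distrib_left mult.assoc)
    also have "\<dots> = (\<Sum>j\<in>I. \<Sum>\<kappa>\<in>K. f i \<kappa> * g \<kappa> j * compl_inv j l)" by (rule sum.swap)
    also have "\<dots> = (\<Sum>j\<in>I. (1 - cut i j) * compl_inv j l)"
      using that by (intro sum.cong) (auto simp: fg sum_distrib_right[symmetric])
    also have "\<dots> = of_bool (i = l)" by (rule compl_inv_right[OF n that])
    finally show ?thesis .
  qed
  moreover have "card I = card K" "finite K" using c by (auto simp: K_def card_Plus)
  \<comment> \<open>As a right inverse of the square factor \<open>f\<close>, \<open>g'\<close> is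
    also a left inverse; the entries of this identity are the biorthogonality relations.\<close>
  ultimately have inv: "(\<Sum>i\<in>I. g' \<kappa> i * f i \<mu>) = of_bool (\<kappa> = \<mu>)" if "\<kappa> \<in> K" "\<mu> \<in> K" for \<kappa> \<mu>
    using that by (intro right_inverse_imp_left_inverse_on[OF finite_I]) auto
  have bal_t: "(\<Sum>j\<in>I. t k j * (of_bool (fst j = b) * (-1) ^ snd j)) = 0"
    if k: "k < c" and b: "b \<in> evens" for k b
  proof -
    let ?l = "(b, ns ! b - 1)"
    have nb: "2 \<le> ns ! b" "even (ns ! b)" using b size_ge_2 by (auto simp: evens_def)
    have l: "?l \<in> I" using b nb by (auto simp: evens_def block_idx_def)
    \<comment> \<open>The last position of an even block is odd, so its column sum is 0 and only the
      alternating column of \<open>cut_inv\<close> remains.\<close>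
    have eq: "compl_inv j ?l = of_bool (fst j = b) * (-1) ^ snd j" if "j \<in> I" for j
    proof -
      obtain m where "ns ! b = Suc m" using nb by (cases "ns ! b") auto
      then show ?thesis using nb that
        by (cases j) (auto simp: compl_inv_def block_idx_def power_add)
    qed
    have "0 = (\<Sum>i\<in>I. g' (Inl k) i * f i (Inr b))"
      using inv[of "Inl k" "Inr b"] k b by (simp add: K_def InlI InrI)
    also have "\<dots> = (\<Sum>i\<in>I. if i = ?l then g' (Inl k) i else 0)"
      by (intro sum.cong) (auto simp: f_def)
    also have "\<dots> = g' (Inl k) ?l" using l by simp
    also have "\<dots> = (\<Sum>j\<in>I. t k j * (of_bool (fst j = b) * (-1) ^ snd j))"
      unfolding g'_def by (intro sum.cong refl) (simp add: g_def eq del: One_nat_def)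
    finally show ?thesis by simp
  qed
  have bal_s: "(\<Sum>i\<in>I. s k i * (of_bool (fst i = b) * (-1) ^ snd i)) = 0"
    if k: "k < c" and b: "b \<in> evens" for k b
  proof -
    let ?l = "(b, 0)"
    have nb: "2 \<le> ns ! b" "even (ns ! b)" using b size_ge_2 by (auto simp: evens_def)
    have l: "?l \<in> I" using b nb by (auto simp: evens_def block_idx_def)
    \<comment> \<open>Dually, position 0 of an even block has row sum 0.\<close>
    have eq: "compl_inv ?l i = - (of_bool (fst i = b) * (-1) ^ snd i)" for i
      using nb by (cases i) (auto simp: compl_inv_def)
    have g': "g' (Inr b) i = compl_inv ?l i" for i
    proof -
      have "g' (Inr b) i = (\<Sum>j\<in>I. if j = ?l then compl_inv j i else 0)"
        unfolding g'_def by (intro sum.cong) (auto simp: g_def)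
      then show ?thesis using l by simp
    qed
    have "0 = (\<Sum>i\<in>I. g' (Inr b) i * f i (Inl k))"
      using inv[of "Inr b" "Inl k"] k b by (simp add: K_def InlI InrI)
    also have "\<dots> = - (\<Sum>i\<in>I. s k i * (of_bool (fst i = b) * (-1) ^ snd i))"
      unfolding sum_negf[symmetric] by (intro sum.cong) (auto simp: f_def g' eq)
    finally show ?thesis by simp
  qed
  let ?n = "real (card I)"
  define x where "x k = (\<Sum>i\<in>I. s k i)" for k
  define y where "y k = (\<Sum>j\<in>I. t k j)" for k
  define x' where "x' k = (\<Sum>i\<in>odd_idx. s k i)" for k
  define y' where "y' k = (\<Sum>j\<in>odd_idx. t k j)" for k
  have n2: "?n - 2 > 0" using n by simp
  have bound: "(?n - 2) * (2 - x' k * y' k) \<le> x k * y k" if k: "k < c" for k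
  proof -
    define h where "h = (\<Sum>i\<in>I. \<Sum>j\<in>I. t k j * cut_inv j i * s k i)"
    have nonneg: "0 \<le> s k i" "0 \<le> t k i" for i by (simp_all add: s_def t_def)
    \<comment> \<open>The diagonal relation, split along the two terms of \<open>compl_inv\<close>;
      balance turns the first into a multiple of \<open>x k * y k\<close>.\<close>
    have "1 = (\<Sum>i\<in>I. g' (Inl k) i * s k i)"
      using inv[of "Inl k" "Inl k"] k by (simp add: K_def f_def InlI)
    also have "\<dots> = (\<Sum>i\<in>I. \<Sum>j\<in>I.
        2 / (?n - 2) * (t k j * cut_inv_row_sum j) * (s k i * cut_inv_col_sum i)
        - t k j * cut_inv j i * s k i)"
      unfolding g'_def sum_distrib_right
      by (intro sum.cong refl) (simp add: g_def compl_inv_def algebra_simps)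
    also have "\<dots> = 2 / (?n - 2) * (\<Sum>j\<in>I. t k j * cut_inv_row_sum j) *
        (\<Sum>i\<in>I. s k i * cut_inv_col_sum i) - h"
      unfolding h_def sum_subtractf by (simp only: sum_distrib_left sum_distrib_right)
    also have "(\<Sum>j\<in>I. t k j * cut_inv_row_sum j) = y k / 2"
      using half_card_if_balanced(1)[OF bal_t[OF k]] by (simp add: y_def)
    also have "(\<Sum>i\<in>I. s k i * cut_inv_col_sum i) = x k / 2"
      using half_card_if_balanced(2)[OF bal_s[OF k]] by (simp add: x_def)
    finally have xy: "x k * y k = 2 * (?n - 2) * (1 + h)" using n2 by (simp add: field_simps)
    \<comment> \<open>An empty side would give \<open>h = 0\<close> and hence a positive
      product.\<close>
    have "x k * y k \<noteq> 0"
    proof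
      assume 0: "x k * y k = 0"
      then have "x k = 0 \<or> y k = 0" by simp
      then have "(\<forall>i\<in>I. s k i = 0) \<or> (\<forall>j\<in>I. t k j = 0)"
        unfolding x_def y_def using nonneg by (simp add: sum_nonneg_eq_0_iff)
      then have "h = 0" unfolding h_def by (auto intro!: sum.neutral)
      then show False using 0 xy n2 by simp
    qed
    moreover have "x k * y k \<ge> 0"
      unfolding x_def y_def using nonneg by (intro mult_nonneg_nonneg sum_nonneg)
    ultimately have "0 < 2 * (?n - 2) * (1 + h)" using xy by linarith
    then have pos: "1 + h > 0" by (rule zero_less_mult_pos) (use n2 in simp)
    have "2 * h = (\<Sum>i\<in>I. \<Sum>j\<in>I. t k j * (2 * cut_inv j i) * s k i)"
      by (simp add: h_def sum_distrib_left mult_ac)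
    also have "\<dots> \<in> \<int>"
      by (intro Ints_sum Ints_mult[OF Ints_mult[OF _ double_cut_inv_in_Ints]])
        (auto simp: s_def t_def)
    finally have "2 * h \<in> \<int>" .
    then obtain z where z: "2 * h = of_int z" by (auto elim: Ints_cases)
    \<comment> \<open>The integer \<open>2 * h\<close> exceeds -2, so it is at least -1.\<close>
    have "real_of_int (- 2) < real_of_int z" using z pos by simp
    then have "z \<ge> - 1" by (simp only: of_int_less_iff)
    then have "real_of_int z \<ge> real_of_int (- 1)" by (simp only: of_int_le_iff)
    then have one: "2 * (1 + h) \<ge> 1" using z by simp
    have "2 - x' k * y' k \<le> 2 * (1 + h)"
    \<comment> \<open>If a side avoids the odd blocks, \<open>h\<close> is an integer and
      \<open>1 + h \<ge> 1\<close>; otherwise \<open>x' k * y' k \<ge> 1\<close> and the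
      half-integral bound suffices.\<close>
    proof (cases "x' k = 0 \<or> y' k = 0")
      case True
      then have avoid: "(\<forall>i\<in>odd_idx. s k i = 0) \<or> (\<forall>j\<in>odd_idx. t k j = 0)"
        unfolding x'_def y'_def using nonneg by (simp add: sum_nonneg_eq_0_iff)
      have "t k j * cut_inv j i * s k i \<in> \<int>" if "i \<in> I" "j \<in> I" for i j
        using avoid cut_inv_in_Ints[OF that(2,1)]
        by (cases "i \<in> odd_idx"; cases "j \<in> odd_idx") (auto simp: s_def t_def)
      then have "h \<in> \<int>" unfolding h_def by (intro Ints_sum)
      then obtain z where "h = of_int z" by (auto elim: Ints_cases)
      then show ?thesis using pos True by auto
    next
      case False
      obtain a b where "x' k = real a" "y' k = real b"
        by (simp add: x'_def y'_def s_def t_def of_bool_def sum.If_cases)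
      then have "x' k \<ge> 1" "y' k \<ge> 1" using False by auto
      then have "x' k * y' k \<ge> 1 * 1" by (intro mult_mono) auto
      then show ?thesis using one by simp
    qed
    then have "(?n - 2) * (2 - x' k * y' k) \<le> (?n - 2) * (2 * (1 + h))"
      using n2 by (intro mult_left_mono) auto
    also have "\<dots> = x k * y k" unfolding xy by (simp add: algebra_simps)
    finally show ?thesis .
  qed
  \<comment> \<open>Double counting of the ones in \<open>U \<times> U\<close>.\<close>
  have count: "(\<Sum>k<c. (\<Sum>i\<in>U. s k i) * (\<Sum>j\<in>U. t k j)) = real (card U) * (real (card U) - 2)"
    if U: "U \<subseteq> I" "\<And>i. i \<in> U \<Longrightarrow> \<sigma> i \<in> U" for U
  proof -
    have "(\<Sum>k<c. (\<Sum>i\<in>U. s k i) * (\<Sum>j\<in>U. t k j)) = (\<Sum>k<c. \<Sum>i\<in>U. \<Sum>j\<in>U. s k i * t k j)"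
      by (simp add: sum_product)
    also have "\<dots> = (\<Sum>i\<in>U. \<Sum>k<c. \<Sum>j\<in>U. s k i * t k j)" by (rule sum.swap)
    also have "\<dots> = (\<Sum>i\<in>U. \<Sum>j\<in>U. \<Sum>k<c. s k i * t k j)"
      by (intro sum.cong refl) (rule sum.swap)
    also have "\<dots> = (\<Sum>i\<in>U. \<Sum>j\<in>U. of_bool (\<not> (j = i \<or> j = \<sigma> i)))"
      unfolding s_def t_def using U(1) by (intro sum.cong refl dec) auto
    also have "\<dots> = real (card U) * (real (card U) - 2)" by (rule sum_entries[OF U])
    finally show ?thesis .
  qed
  have "(?n - 2) * (2 * real c - real (card odd_idx) * (real (card odd_idx) - 2)) =
      (\<Sum>k<c. (?n - 2) * (2 - x' k * y' k))"
  proof -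
    have "(\<Sum>k<c. x' k * y' k) = real (card odd_idx) * (real (card odd_idx) - 2)"
      unfolding x'_def y'_def
      by (rule count[OF _ succ_in_odd_idx]) (auto simp: odd_idx_def)
    then show ?thesis by (simp add: sum_distrib_left[symmetric] sum_subtractf)
  qed
  also have "\<dots> \<le> (\<Sum>k<c. x k * y k)" using bound by (intro sum_mono) auto
  also have "\<dots> = (?n - 2) * ?n"
    unfolding x_def y_def by (subst count) (auto simp: succ_in_I)
  finally have "2 * real c - real (card odd_idx) * (real (card odd_idx) - 2) \<le> ?n"
    using n2 by simp
  then show ?thesis by simp
qed

section \<open>The decomposition for the upper bound\<close>

text \<open>The column set common to all even blocks: it belongs to the rows with a zero at position 0.
  It is the index \<open>None\<close> below; \<open>Some (b, q)\<close> belongs to the rows of an even block \<open>b\<close> with a zero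
  at position \<open>q > 0\<close>.\<close>

definition even_cols :: "(nat \<times> nat) set" where
  "even_cols = {(b, p). even (ns ! b) \<and> even p \<and> p \<noteq> 0}"

text \<open>In an even block, a zero at \<open>q > 0\<close> occurs in the rows \<open>q\<close> and
  \<open>q - 1\<close>, a zero at 0 in the first and the last row.\<close>

fun rect_rows :: "(nat \<times> nat) option \<Rightarrow> (nat \<times> nat) set" where
  "rect_rows None = {(b, p). even (ns ! b) \<and> (p = 0 \<or> Suc p = ns ! b)}"
| "rect_rows (Some (b, q)) = (if odd (ns ! b) then {(b, q)} else {(b, q), (b, q - 1)})"

text \<open>In an even block \<open>b\<close>, the set \<open>U = insert (b, 0) even_cols\<close>
  contains the even positions of \<open>b\<close> and none of the odd ones. A row with zeros at an
  even \<open>x\<close> and an odd \<open>y\<close> has its ones on \<open>U - {x}\<close> and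
  \<open>- U - {y}\<close>. Sharing is possible because \<open>U - {(b, 0)}\<close> is
  \<open>even_cols\<close> for every such \<open>b\<close>.\<close>

fun rect_cols :: "(nat \<times> nat) option \<Rightarrow> (nat \<times> nat) set" where
  "rect_cols None = even_cols"
| "rect_cols (Some (b, q)) =
     (if odd (ns ! b) then - {(b, q), \<sigma> (b, q)}
      else if even q then insert (b, 0) even_cols - {(b, q)}
      else - insert (b, 0) even_cols - {(b, q)})"

text \<open>For even \<open>b\<close>, \<open>None\<close> takes over the role of
  \<open>Some (b, 0)\<close>: one index is added and one per even block is saved.\<close>

definition rect_idx :: "(nat \<times> nat) option set" where
  "rect_idx = insert None (Some ` (I - (\<lambda>b. (b, 0)) ` evens))"

lemma finite_rect_idx [simp]: "finite rect_idx"
  by (simp add: rect_idx_def)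

lemma in_rect_idx:
  "None \<in> rect_idx"
  "Some (b, q) \<in> rect_idx \<longleftrightarrow> (b, q) \<in> I \<and> \<not> (even (ns ! b) \<and> q = 0)"
  by (auto simp: rect_idx_def evens_def block_idx_def)

lemma card_rect_idx: "card rect_idx + card evens = card I + 1"
proof -
  have sub: "(\<lambda>b. (b, 0)) ` evens \<subseteq> I"
    using size_ge_2 by (fastforce simp: evens_def block_idx_def)
  have "card ((\<lambda>b. (b, 0::nat)) ` evens) = card evens" by (intro card_image) (auto simp: inj_on_def)
  then have "card (I - (\<lambda>b. (b, 0)) ` evens) + card evens = card I"
    using card_Diff_subset[OF _ sub] card_mono[OF finite_I sub] by simp
  then show ?thesis by (simp add: rect_idx_def card_image)
qed

lemma rect_decomposition:
  assumes i: "i \<in> I"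
  shows "(\<Sum>k\<in>rect_idx. of_bool (i \<in> rect_rows k) * of_bool (j \<in> rect_cols k)) =
    (of_bool (\<not> (j = i \<or> j = \<sigma> i)) :: int)"
proof -
  obtain b p where bp: "i = (b, p)" by fastforce
  have b: "b < length ns" and p: "p < ns ! b" using i by (auto simp: bp block_idx_def)
  have n2: "2 \<le> ns ! b" using size_ge_2[OF b] .
  have "(\<Sum>k\<in>rect_idx. of_bool (i \<in> rect_rows k) * of_bool (j \<in> rect_cols k)) =
      (\<Sum>k\<in>{k \<in> rect_idx. i \<in> rect_rows k}. of_bool (j \<in> rect_cols k) :: int)"
    by (intro sum.mono_neutral_cong_right) auto
  also have "\<dots> = of_bool (\<not> (j = i \<or> j = \<sigma> i))"
  proof (cases "even (ns ! b)")
    case False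
    then have "{k \<in> rect_idx. i \<in> rect_rows k} = {Some (b, p)}"
      using i
      by (intro Set.set_eqI, rename_tac k, case_tac k)
          (auto simp: in_rect_idx bp block_idx_def split: if_splits)
    then show ?thesis using False by (simp add: bp)
  next
    case ev: True
    define U where "U = insert (b, 0) even_cols"
    have U: "(b, q) \<in> U \<longleftrightarrow> even q" for q using ev by (auto simp: U_def even_cols_def)
    have U0: "even_cols = U - {(b, 0)}" by (auto simp: U_def even_cols_def)
    have split: "of_bool (j \<in> U - {x}) + of_bool (j \<in> - U - {y}) =
        (of_bool (\<not> (j = x \<or> j = y)) :: int)" if "x \<in> U" "y \<notin> U" for x y
      using that by auto
    have cols: "rect_cols (Some (b, q)) = (if even q then U - {(b, q)} else - U - {(b, q)})" for q
      using ev by (simp add: U_def)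
    \<comment> \<open>The zeros are at 0 and 1, at \<open>p\<close> and 0, or at \<open>p\<close>
      and \<open>p + 1\<close>; in the first two cases \<open>None\<close> serves the zero at
      0.\<close>
    consider "p = 0" | "p \<noteq> 0" "Suc p = ns ! b" | "p \<noteq> 0" "Suc p < ns ! b" using p by linarith
    then show ?thesis
    proof cases
      case 1
      then have "{k \<in> rect_idx. i \<in> rect_rows k} = {None, Some (b, 1)}"
        using ev b n2
        by (intro Set.set_eqI, rename_tac k, case_tac k)
          (auto simp: in_rect_idx bp block_idx_def split: if_splits)
      then show ?thesis using ev n2 1 split[of "(b, 0)" "(b, 1)"]
        by (simp add: bp U U0 cols del: rect_cols.simps(2) sum_of_bool_eq)
    next
      case 2
      then have "{k \<in> rect_idx. i \<in> rect_rows k} = {None, Some (b, p)}"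
        using ev b n2
        by (intro Set.set_eqI, rename_tac k, case_tac k)
          (auto simp: in_rect_idx bp block_idx_def split: if_splits)
      moreover have "odd p" using 2 ev by presburger
      ultimately show ?thesis using ev n2 2 split[of "(b, 0)" "(b, p)"]
        by (simp add: bp U U0 cols disj_commute del: rect_cols.simps(2) sum_of_bool_eq)
    next
      case 3
      then have "{k \<in> rect_idx. i \<in> rect_rows k} = {Some (b, p), Some (b, Suc p)}"
        using ev b n2
        by (intro Set.set_eqI, rename_tac k, case_tac k)
          (auto simp: in_rect_idx bp block_idx_def split: if_splits)
      then show ?thesis
        using ev 3 split[of "(b, p)" "(b, Suc p)"] split[of "(b, Suc p)" "(b, p)"]
        by (cases "even p")
          (simp_all add: bp U cols disj_commute add.commute del: rect_cols.simps(2) sum_of_bool_eq)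
    qed
  qed
  finally show ?thesis .
qed

end

section \<open>Transport between block coordinates and matrix indices\<close>

theorem theorem5p2:
  fixes ns :: "nat list" and M :: "int mat" and m m_even n_even n_odd n :: nat
  assumes "m = length ns" and "m \<ge> 1"
    and "\<And>i. i < m \<Longrightarrow> ns ! i \<ge> 2"
    and "M = complement_mat (circulant_block_diag 2 ns)"
    and "m_even = card {i. i < m \<and> even (ns ! i)}"
    and "n_even = (\<Sum>i | i < m \<and> even (ns ! i). ns ! i)"
    and "n_odd = (\<Sum>i | i < m \<and> odd (ns ! i). ns ! i)"
    and "n = n_even + n_odd"
    and "odd n"
    and "int n > 2 * int m_even + int n_odd * (int n_odd - 2)"
  shows "int (binary_rank M) = int n - int m_even + 1"
proof -
  interpret cycle_blocks ns using assms(1,3) by unfold_locales auto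
  have evens: "card evens = m_even" using assms(1,5) by (simp add: evens_def)
  have "n = (\<Sum>i<m. ns ! i)"
  proof -
    have "(\<Sum>i<m. ns ! i) = (\<Sum>i\<in>{i. i < m \<and> even (ns ! i)} \<union> {i. i < m \<and> odd (ns ! i)}. ns ! i)"
      by (rule sum.cong) auto
    also have "\<dots> = n_even + n_odd" unfolding assms(6,7) by (rule sum.union_disjoint) auto
    finally show ?thesis using assms(8) by simp
  qed
  then have n: "n = sum_list ns" using assms(1) by (simp add: sum_list_sum_nth atLeast0LessThan)
  then have card_n: "card I = n" using card_I by simp
  have odd: "card odd_idx = n_odd"
  proof -
    have "odd_idx = (SIGMA b:{i. i < m \<and> odd (ns ! i)}. {..<ns ! b})"
      using assms(1) by (auto simp: odd_idx_def block_idx_def)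
    then show ?thesis using assms(7) by simp
  qed
  \<comment> \<open>Oddness of \<open>n\<close> excludes 2, where the factor
    \<open>2 / (n - 2)\<close> would degenerate.\<close>
  have n2: "n > 2"
  proof -
    have "ns ! 0 \<le> (\<Sum>i<m. ns ! i)" using assms(2) by (intro member_le_sum) auto
    then have "n \<ge> 2" using \<open>n = (\<Sum>i<m. ns ! i)\<close> assms(2) assms(3)[of 0] by simp
    then show ?thesis using assms(9) by (cases "n = 2") auto
  qed
  have bij: "bij_betw (block_loc ns) {..<n} I" using bij_betw_block_loc n by simp
  have loc: "block_loc ns i \<in> I" if "i < n" for i using bij that by (auto simp: bij_betw_def)
  have dim: "dim_row M = n" "dim_col M = n" using assms(4) n by (simp_all add: complement_mat_def)
  have "\<forall>x\<in>set ns. 2 \<le> x" using assms(1,3) by (auto simp: in_set_conv_nth)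
  then have entry: "M $$ (i, j) =
      of_bool (\<not> (block_loc ns j = block_loc ns i \<or> block_loc ns j = \<sigma> (block_loc ns i)))"
    if "i < n" "j < n" for i j
    using that assms(4) n by (simp add: complement_mat_def circulant_block_diag_two_index)
  have bin: "M $$ (i, j) \<in> {0, 1}" if "i < dim_row M" "j < dim_col M" for i j
    using that by (auto simp: dim entry)
  have "binary_rank M \<le> card rect_idx"
  proof (rule binary_rank_le[where S = "\<lambda>k. block_loc ns -` rect_rows k"
        and T = "\<lambda>k. block_loc ns -` rect_cols k", OF _ bin])
    fix i j assume "i < dim_row M" "j < dim_col M"
    then show "M $$ (i, j) = (\<Sum>k\<in>rect_idx. of_bool (i \<in> block_loc ns -` rect_rows k) *
        of_bool (j \<in> block_loc ns -` rect_cols k))"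
      using rect_decomposition[OF loc, of i "block_loc ns j"] by (simp add: dim entry)
  qed auto
  then have upper: "binary_rank M + m_even \<le> n + 1"
    using card_rect_idx card_n evens by linarith
  have lower: "n + 1 \<le> binary_rank M + m_even"
  proof (rule ccontr)
    assume "\<not> n + 1 \<le> binary_rank M + m_even"
    moreover define c where "c = n - m_even"
    \<comment> \<open>Guards the truncated subtraction in \<open>c\<close>; the summand 1 in
      \<open>card_rect_idx\<close> is the index \<open>None\<close>.\<close>
    moreover have "m_even \<le> n" using card_rect_idx card_n evens by (simp add: rect_idx_def)
    ultimately have c: "binary_rank M \<le> c" "c + m_even = n" by auto
    obtain S T :: "nat \<Rightarrow> nat set" where ST: "\<And>i j. i < dim_row M \<Longrightarrow> j < dim_col M \<Longrightarrow>
        M $$ (i, j) = (\<Sum>k<c. of_bool (i \<in> S k) * of_bool (j \<in> T k))"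
      using binary_rank_le_imp_decomposition[OF c(1) bin] by blast
    define \<psi> where "\<psi> = inv_into {..<n} (block_loc ns)"
    have \<psi>: "\<psi> i < n" "block_loc ns (\<psi> i) = i" if "i \<in> I" for i
      using that bij inv_into_into[of i "block_loc ns" "{..<n}"]
        f_inv_into_f[of i "block_loc ns" "{..<n}"]
      by (auto simp: \<psi>_def bij_betw_def)
    have "2 * real c \<le> real (card I) + real (card odd_idx) * (real (card odd_idx) - 2)"
    proof (rule decomposition_size_bound[where S = "\<lambda>k. \<psi> -` S k" and T = "\<lambda>k. \<psi> -` T k"])
      fix i j assume ij: "i \<in> I" "j \<in> I"
      have "(\<Sum>k<c. of_bool (\<psi> i \<in> S k) * of_bool (\<psi> j \<in> T k)) =
          (of_bool (\<not> (j = i \<or> j = \<sigma> i)) :: int)"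
        using ST[of "\<psi> i" "\<psi> j"] entry[of "\<psi> i" "\<psi> j"] \<psi>[OF ij(1)] \<psi>[OF ij(2)] dim by simp
      from arg_cong[OF this, of real_of_int]
      show "(\<Sum>k<c. of_bool (i \<in> \<psi> -` S k) * of_bool (j \<in> \<psi> -` T k)) =
          (of_bool (\<not> (j = i \<or> j = \<sigma> i)) :: real)" by simp
    qed (use n2 c card_n evens in auto)
    then have "real_of_int (2 * int c) \<le> real_of_int (int n + int n_odd * (int n_odd - 2))"
      by (simp add: card_n odd)
    then have "2 * int c \<le> int n + int n_odd * (int n_odd - 2)" by (simp only: of_int_le_iff)
    \<comment> \<open>With \<open>c = n - m_even\<close> the bound reads
      \<open>n \<le> 2 * m_even + n_odd * (n_odd - 2)\<close>.\<close>
    then show False using assms(10) c(2) by linarith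
  qed
  show ?thesis using upper lower by linarith
qed

end
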